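(* Let $T>0$ and let $\rho_i,v_i\in\mathcal{C}^1(]0,T[\times\mathbb{R})$, $i=1,2$, with $\rho_1>0$, $\rho_2>0$ and $v_1>v_2$ on $]0,T[\times\mathbb{R}$. Define $$f(t,x,v)=\sum_{i=1}^2\rho_i(t,x)\,\delta(v-v_i(t,x)).$$ Then $\rho_i,v_i$ solve in $]0,T[\times\mathbb{R}$ the four-moment system $$\partial_tM_k+\partial_xM_{k+1}=0,\quad k=0,1,2,3,\qquad\text{where } M_k=\rho_1v_1^k+\rho_2v_2^k\ \ (k=0,\dots,4),$$ or, equivalently, solve in $]0,T[\times\mathbb{R}$ the system $$\partial_t\rho_i+\partial_x(\rho_iv_i)=0,\qquad \partial_t(\rho_iv_i)+\partial_x(\rho_iv_i^2)=0,\qquad i=1,2,$$ if and only if $$\partial_tf+v\,\partial_xf=0\quad\text{in } ]0,T[\times\mathbb{R}\times\mathbb{R}$$ in the distributional sense, i.e. if and only if for all $\phi\in\mathcal{C}_c^\infty(]0,T[\times\mathbb{R})$ and all $\chi\in\mathcal{C}_c^\infty(\mathbb{R})$, $$\int_0^T\int_{\mathbb{R}}\sum_{i=1}^2\rho_i(t,x)\big(\partial_t\phi(t,x)+v_i(t,x)\,\partial_x\phi(t,x)\big)\,\chi\big(v_i(t,x)\big)\,dx\,dt=0.$$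
   Context: Here $\delta$ denotes the Dirac delta function in the velocity variable. The system for $(\rho_i,v_i)$, $i=1,2$, consists of two decoupled pressureless gas dynamics systems. All equations for the $\mathcal{C}^1$ functions $\rho_i,v_i$ are understood in the classical (pointwise) sense. *)

theory Defs
  imports "HOL-Analysis.Analysis"
begin

text \<open>
  \<open>C\<^sup>k\<close> regularity on an open set. As the domain is finite-dimensional, continuity of
  \<open>x \<mapsto> D f(x) u\<close> for every fixed direction \<open>u\<close> is continuity of \<open>D f\<close>.
\<close>

primrec C_k_on :: "nat \<Rightarrow> 'a::euclidean_space set \<Rightarrow> ('a \<Rightarrow> real) \<Rightarrow> bool" where
  "C_k_on 0 S f \<longleftrightarrow> continuous_on S f"
| "C_k_on (Suc k) S f \<longleftrightarrow>
     (\<forall>x\<in>S. f differentiable (at x)) \<and>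
     (\<forall>u. C_k_on k S (\<lambda>x. frechet_derivative f (at x) u))"

definition smooth_on :: "'a::euclidean_space set \<Rightarrow> ('a \<Rightarrow> real) \<Rightarrow> bool" where
  "smooth_on S f \<longleftrightarrow> (\<forall>k. C_k_on k S f)"

text \<open>
  Elements of \<open>C\<^sub>c\<^sup>\<infinity>(\<Omega>)\<close>, identified with their extensions by zero to the whole space.
\<close>

definition test_function :: "'a::euclidean_space set \<Rightarrow> ('a \<Rightarrow> real) \<Rightarrow> bool" where
  "test_function \<Omega> \<phi> \<longleftrightarrow>
     smooth_on UNIV \<phi> \<and> compact (closure {x. \<phi> x \<noteq> 0}) \<and> closure {x. \<phi> x \<noteq> 0} \<subseteq> \<Omega>"

definition strip :: "real \<Rightarrow> (real \<times> real) set" where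
  "strip T = {0<..<T} \<times> UNIV"

definition Dt :: "(real \<times> real \<Rightarrow> real) \<Rightarrow> real \<times> real \<Rightarrow> real" where
  "Dt g = (\<lambda>(t, x). deriv (\<lambda>s. g (s, x)) t)"

definition Dx :: "(real \<times> real \<Rightarrow> real) \<Rightarrow> real \<times> real \<Rightarrow> real" where
  "Dx g = (\<lambda>(t, x). deriv (\<lambda>y. g (t, y)) x)"

definition moment ::
  "(nat \<Rightarrow> real \<times> real \<Rightarrow> real) \<Rightarrow> (nat \<Rightarrow> real \<times> real \<Rightarrow> real) \<Rightarrow> nat \<Rightarrow> real \<times> real \<Rightarrow> real" where
  "moment \<rho> v k p = \<rho> 1 p * v 1 p ^ k + \<rho> 2 p * v 2 p ^ k"

definition four_moment_system ::
  "real \<Rightarrow> (nat \<Rightarrow> real \<times> real \<Rightarrow> real) \<Rightarrow> (nat \<Rightarrow> real \<times> real \<Rightarrow> real) \<Rightarrow> bool" where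
  "four_moment_system T \<rho> v \<longleftrightarrow>
     (\<forall>k\<in>{0..3}. \<forall>p\<in>strip T. Dt (moment \<rho> v k) p + Dx (moment \<rho> v (k + 1)) p = 0)"

definition pressureless_systems ::
  "real \<Rightarrow> (nat \<Rightarrow> real \<times> real \<Rightarrow> real) \<Rightarrow> (nat \<Rightarrow> real \<times> real \<Rightarrow> real) \<Rightarrow> bool" where
  "pressureless_systems T \<rho> v \<longleftrightarrow>
     (\<forall>i\<in>{1, 2}. \<forall>p\<in>strip T.
        Dt (\<rho> i) p + Dx (\<lambda>q. \<rho> i q * v i q) p = 0 \<and>
        Dt (\<lambda>q. \<rho> i q * v i q) p + Dx (\<lambda>q. \<rho> i q * (v i q)\<^sup>2) p = 0)"

text \<open>
  A distribution in the velocity variable is represented by its action on functions of the velocity.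
\<close>

definition dirac :: "real \<Rightarrow> (real \<Rightarrow> real) \<Rightarrow> real" where
  "dirac a \<psi> = \<psi> a"

definition two_node_density ::
  "(nat \<Rightarrow> real \<times> real \<Rightarrow> real) \<Rightarrow> (nat \<Rightarrow> real \<times> real \<Rightarrow> real) \<Rightarrow>
     real \<times> real \<Rightarrow> (real \<Rightarrow> real) \<Rightarrow> real" where
  "two_node_density \<rho> v p \<psi> = (\<Sum>i\<in>{1, 2}. \<rho> i p * dirac (v i p) \<psi>)"

text \<open>
  \<open>\<partial>\<^sub>t f + \<xi> \<partial>\<^sub>x f = 0\<close> in the sense of distributions on \<open>]0,T[ \<times> \<real> \<times> \<real>\<close>, for \<open>f\<close> given by a
  distribution in \<open>\<xi>\<close> at each \<open>(t,x)\<close>. All test functions \<open>\<Phi>(t,x,\<xi>)\<close> are admitted, not only the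
  products \<open>\<phi>(t,x) \<psi>(\<xi>)\<close>.
\<close>

definition free_transport_distributional ::
  "real \<Rightarrow> (real \<times> real \<Rightarrow> (real \<Rightarrow> real) \<Rightarrow> real) \<Rightarrow> bool" where
  "free_transport_distributional T f \<longleftrightarrow>
     (\<forall>\<Phi> :: real \<times> real \<times> real \<Rightarrow> real. test_function ({0<..<T} \<times> UNIV \<times> UNIV) \<Phi> \<longrightarrow>
        (LBINT t:{0<..<T}. LBINT x.
           f (t, x) (\<lambda>\<xi>. Dt (\<lambda>(s, y). \<Phi> (s, y, \<xi>)) (t, x) + \<xi> * Dx (\<lambda>(s, y). \<Phi> (s, y, \<xi>)) (t, x))) = 0)"

end

theory Submission
  imports Defs
begin

text \<open>
  Put \<open>m\<^sub>i = \<partial>\<^sub>t\<rho>\<^sub>i + \<partial>\<^sub>x(\<rho>\<^sub>iv\<^sub>i)\<close> and \<open>n\<^sub>i = \<rho>\<^sub>i(\<partial>\<^sub>tv\<^sub>i + v\<^sub>i\<partial>\<^sub>xv\<^sub>i)\<close>. All the systems are equivalent to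
  \<open>m\<^sub>i = n\<^sub>i = 0\<close>. The \<open>k\<close>-th moment equation reads \<open>\<Sum>\<^sub>i P(v\<^sub>i)m\<^sub>i + P'(v\<^sub>i)n\<^sub>i = 0\<close> with
  \<open>P = \<xi>\<^sup>k\<close>, so for \<open>k \<le> 3\<close> Hermite interpolation at \<open>v\<^sub>1 \<noteq> v\<^sub>2\<close> makes all residuals vanish.
  Integrating by parts along \<open>\<xi> = v\<^sub>i(t,x)\<close>, the transport equation tested with \<open>\<Phi>(t,x,\<xi>)\<close> becomes
  \<open>\<integral> \<Sum>\<^sub>i \<Phi>(t,x,v\<^sub>i)m\<^sub>i + \<partial>\<^sub>\<xi>\<Phi>(t,x,v\<^sub>i)n\<^sub>i = 0\<close>. For \<open>\<Phi> = \<phi>(t,x)\<psi>(\<xi>)\<close> the fundamental lemma gives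
  \<open>\<Sum>\<^sub>i \<psi>(v\<^sub>i)m\<^sub>i + \<psi>'(v\<^sub>i)n\<^sub>i = 0\<close> pointwise, and test functions \<open>\<psi>\<close> supported away from one of the
  two nodes isolate the residuals at the other.
\<close>

section \<open>Calculus of \<open>C\<^sup>k\<close> functions\<close>

text \<open>Derivatives are local, so on an open set \<open>f\<close> and \<open>g\<close> have the
  same directional derivatives, and the induction passes to these.\<close>

lemma C_k_on_cong:
  assumes "open S" "\<And>x. x \<in> S \<Longrightarrow> f x = g x" "C_k_on k S f"
  shows "C_k_on k S g"
  using assms(2,3)
proof (induction k arbitrary: f g)
  case 0
  then show ?case using continuous_on_cong by (metis C_k_on.simps(1))
next
  case (Suc k)
  have d: "f differentiable (at x)" if "x \<in> S" for x
    using Suc.prems(2) that by simp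
  have D: "frechet_derivative f (at x) = frechet_derivative g (at x)" if "x \<in> S" for x
    using frechet_derivative_transform_within_open[OF d[OF that] assms(1) that] Suc.prems(1) by blast
  have "g differentiable (at x)" if "x \<in> S" for x
  proof -
    have "(f has_derivative frechet_derivative f (at x)) (at x)"
      using d[OF that] frechet_derivative_works by blast
    then have "(g has_derivative frechet_derivative f (at x)) (at x)"
      using has_derivative_transform_within_open[OF _ assms(1) that] Suc.prems(1) by blast
    then show ?thesis
      by (auto simp: differentiable_def)
  qed
  moreover have "C_k_on k S (\<lambda>x. frechet_derivative g (at x) u)" for u
    by (rule Suc.IH[of "\<lambda>x. frechet_derivative f (at x) u"]) (use D Suc.prems(2) in simp_all)
  ultimately show ?case by simp
qed

text \<open>By uniqueness of the derivative, an explicit \<open>f'\<close> may stand in for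
  \<open>frechet_derivative f\<close>. The closure properties below rest on this rule.\<close>

lemma C_k_on_SucI:
  assumes "open S" "\<And>x. x \<in> S \<Longrightarrow> (f has_derivative f' x) (at x)"
    and "\<And>u. C_k_on k S (\<lambda>x. f' x u)"
  shows "C_k_on (Suc k) S f"
proof -
  have "C_k_on k S (\<lambda>x. frechet_derivative f (at x) u)" for u
    by (rule C_k_on_cong[OF assms(1) _ assms(3)[of u]]) (simp add: frechet_derivative_at[OF assms(2), symmetric])
  with assms(2) show ?thesis by (auto simp: differentiable_def)
qed

lemma C_k_on_Suc_has_derivative:
  "C_k_on (Suc k) S f \<Longrightarrow> x \<in> S \<Longrightarrow> (f has_derivative frechet_derivative f (at x)) (at x)"
  using frechet_derivative_works by auto

text \<open>\<open>C_k_on (Suc k)\<close> does not mention continuity of \<open>f\<close> itself.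
  Differentiability supplies it at level 0; above that, the induction acts on the directional
  derivatives.\<close>

lemma C_k_on_SucD: "C_k_on (Suc k) S f \<Longrightarrow> C_k_on k S f"
proof (induction k arbitrary: f)
  case 0
  then show ?case
    by (auto intro!: continuous_at_imp_continuous_on differentiable_imp_continuous_within)
qed auto

lemma C_k_on_antimono: "j \<le> k \<Longrightarrow> C_k_on k S f \<Longrightarrow> C_k_on j S f"
  by (induction k rule: dec_induct) (auto dest: C_k_on_SucD simp del: C_k_on.simps)

lemma C_k_on_imp_continuous_on: "C_k_on k S f \<Longrightarrow> continuous_on S f"
  using C_k_on_antimono[of 0 k S f] by simp

lemma C_k_on_const: "open S \<Longrightarrow> C_k_on k S (\<lambda>x. c)"
proof (induction k arbitrary: c)
  case (Suc k)
  then show ?case by (intro C_k_on_SucI[where f' = "\<lambda>x u. 0"]) auto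
qed simp

lemma C_k_on_linear:
  assumes "open S" "bounded_linear f"
  shows "C_k_on k S f"
proof (cases k)
  case 0
  then show ?thesis using assms by (simp add: linear_continuous_on)
next
  case (Suc n)
  show ?thesis unfolding Suc
    by (rule C_k_on_SucI[where f' = "\<lambda>x. f"])
       (simp_all add: assms bounded_linear_imp_has_derivative C_k_on_const del: C_k_on.simps)
qed

lemma C_k_on_add:
  assumes "open S"
  shows "C_k_on k S f \<Longrightarrow> C_k_on k S g \<Longrightarrow> C_k_on k S (\<lambda>x. f x + g x)"
proof (induction k arbitrary: f g)
  case 0
  then show ?case by (simp add: continuous_on_add)
next
  case (Suc k)
  show ?case
    by (rule C_k_on_SucI[OF assms has_derivative_add[OF
          C_k_on_Suc_has_derivative[OF Suc.prems(1)] C_k_on_Suc_has_derivative[OF Suc.prems(2)]]])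
       (use Suc in auto)
qed

text \<open>The product rule pairs each factor with a derivative of the other, so the factors are
  also needed at level \<open>k\<close>, which \<open>C_k_on_SucD\<close> gives.\<close>

lemma C_k_on_mult:
  assumes "open S"
  shows "C_k_on k S f \<Longrightarrow> C_k_on k S g \<Longrightarrow> C_k_on k S (\<lambda>x. f x * g x)"
proof (induction k arbitrary: f g)
  case 0
  then show ?case by (simp add: continuous_on_mult)
next
  case (Suc k)
  show ?case
    by (rule C_k_on_SucI[OF assms has_derivative_mult[OF
          C_k_on_Suc_has_derivative[OF Suc.prems(1)] C_k_on_Suc_has_derivative[OF Suc.prems(2)]]],
        assumption, assumption, rule C_k_on_add[OF assms])
       (use Suc.IH Suc.prems C_k_on_SucD[OF Suc.prems(1)] C_k_on_SucD[OF Suc.prems(2)] in auto)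
qed

lemma C_k_on_diff:
  assumes "open S" "C_k_on k S f" "C_k_on k S g"
  shows "C_k_on k S (\<lambda>x. f x - g x)"
  using C_k_on_add[OF assms(1,2) C_k_on_mult[OF assms(1) C_k_on_const[OF assms(1), of _ "-1"] assms(3)]]
  by simp

lemma C_k_on_power:
  assumes "open S" "C_k_on k S f"
  shows "C_k_on k S (\<lambda>x. f x ^ n)"
  by (induction n) (simp_all add: C_k_on_const[OF assms(1)] C_k_on_mult[OF assms(1) assms(2)])

text \<open>The derivative in direction \<open>u\<close> is the derivative of \<open>f\<close> in
  direction \<open>L u\<close>, composed with \<open>L\<close>: the same form again, so the
  induction closes.\<close>

lemma C_k_on_compose_linear:
  fixes L :: "'a::euclidean_space \<Rightarrow> 'b::euclidean_space"
  assumes "bounded_linear L"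
  shows "C_k_on k UNIV f \<Longrightarrow> C_k_on k UNIV (\<lambda>x. f (L x))"
proof (induction k arbitrary: f)
  case 0
  then show ?case
    using continuous_on_compose2[of UNIV f UNIV L] linear_continuous_on[OF assms] by simp
next
  case (Suc k)
  have "((\<lambda>x. f (L x)) has_derivative (\<lambda>u. frechet_derivative f (at (L x)) (L u))) (at x)" for x
    using has_derivative_compose[OF bounded_linear_imp_has_derivative[OF assms]
        C_k_on_Suc_has_derivative[OF Suc.prems]] by simp
  then show ?case
    by (rule C_k_on_SucI[OF open_UNIV]) (use Suc in auto)
qed

text \<open>For a scalar outer function the chain rule is a genuine product, \<open>g'(f x)\<close>
  times a directional derivative of \<open>f\<close>, so induction and the product rule
  suffice.\<close>

lemma C_k_on_compose_real:
  fixes g :: "real \<Rightarrow> real"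
  assumes "open S"
  shows "C_k_on k UNIV g \<Longrightarrow> C_k_on k S f \<Longrightarrow> C_k_on k S (\<lambda>x. g (f x))"
proof (induction k arbitrary: f g)
  case 0
  then show ?case
    using continuous_on_compose2[of UNIV g S f] by simp
next
  case (Suc k)
  have lin: "frechet_derivative g (at y) v = frechet_derivative g (at y) 1 * v" for y v
    using linear_frechet_derivative[of g "at y"] Suc.prems(1)
      linear_scale[of "frechet_derivative g (at y)" v 1] by simp
  have "((\<lambda>x. g (f x)) has_derivative
      (\<lambda>u. frechet_derivative g (at (f x)) 1 * frechet_derivative f (at x) u)) (at x)" if "x \<in> S" for x
    using has_derivative_compose[OF C_k_on_Suc_has_derivative[OF Suc.prems(2) that]
        C_k_on_Suc_has_derivative[OF Suc.prems(1)]] by (subst lin[symmetric]) simp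
  then show ?case
  proof (rule C_k_on_SucI[OF assms])
    show "C_k_on k S (\<lambda>x. frechet_derivative g (at (f x)) 1 * frechet_derivative f (at x) u)" for u
      by (rule C_k_on_mult[OF assms Suc.IH[OF _ C_k_on_SucD[OF Suc.prems(2)]]])
         (use Suc.prems in simp_all)
  qed
qed

section \<open>Test functions\<close>

text \<open>\<open>flat 0\<close> is the classical smooth, non-analytic function. The extra powers
  make the family closed under differentiation up to linear combinations.\<close>

definition flat :: "nat \<Rightarrow> real \<Rightarrow> real" where
  "flat n x = (if x > 0 then inverse x ^ n * exp (- inverse x) else 0)"

text \<open>From the right, substitute \<open>y = 1/x\<close> and use that the exponential dominates
  powers; from the left the function is zero.\<close>

lemma flat_tendsto_0: "(flat n \<longlongrightarrow> 0) (at 0)"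
proof -
  have "((\<lambda>y::real. y ^ n / exp y) \<longlongrightarrow> 0) at_top"
    by (rule tendsto_power_div_exp_0)
  then have "((\<lambda>x::real. inverse x ^ n / exp (inverse x)) \<longlongrightarrow> 0) (at_right 0)"
    using filterlim_compose filterlim_inverse_at_top_right by blast
  then have "(flat n \<longlongrightarrow> 0) (at_right 0)"
    by (rule Lim_transform_eventually)
       (auto simp: eventually_at_right_field flat_def exp_minus divide_inverse intro: exI[of _ 1])
  moreover have "(flat n \<longlongrightarrow> 0) (at_left 0)"
    by (rule Lim_transform_eventually[OF tendsto_const])
       (auto simp: eventually_at_left_field flat_def intro: exI[of _ "-1"])
  ultimately show ?thesis
    by (simp add: filterlim_split_at)
qed

lemma flat_has_real_derivative:
  "(flat n has_real_derivative flat (n + 2) x - real n * flat (n + 1) x) (at x)"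
proof -
  consider "x > 0" | "x < 0" | "x = 0" by linarith
  then show ?thesis
  proof cases
    case 1
    have pow: "y * y ^ (n - Suc 0) = y ^ n" if "n \<noteq> 0" for y :: real
      using that by (cases n) auto
    have "((\<lambda>x. inverse x ^ n * exp (- inverse x)) has_real_derivative
        flat (n + 2) x - real n * flat (n + 1) x) (at x)"
      using 1 by (cases "n = 0") (auto intro!: derivative_eq_intros simp: flat_def algebra_simps pow)
    then show ?thesis
      by (rule has_field_derivative_transform_within_open[of _ _ _ "{0<..}"]) (use 1 in \<open>auto simp: flat_def\<close>)
  next
    case 2
    have "((\<lambda>x. 0) has_real_derivative flat (n + 2) x - real n * flat (n + 1) x) (at x)"
      using 2 by (simp add: flat_def)
    then show ?thesis
      by (rule has_field_derivative_transform_within_open[of _ _ _ "{..<0}"]) (use 2 in \<open>auto simp: flat_def\<close>)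
  next
    case 3
    \<comment> \<open>The difference quotient at the origin is again a member of the family, also at
      \<open>h = 0\<close>, where division by zero yields 0.\<close>
    have "(\<lambda>h. (flat n (0 + h) - flat n 0) / h) = flat (n + 1)"
      by (auto simp: fun_eq_iff flat_def field_simps)
    then have "(flat n has_real_derivative 0) (at 0)"
      using flat_tendsto_0[of "n + 1"] by (simp add: DERIV_def)
    then show ?thesis using 3 by (simp add: flat_def)
  qed
qed

lemma C_k_on_flat: "C_k_on k UNIV (flat n)"
proof (induction k arbitrary: n)
  case 0
  then show ?case
    using DERIV_isCont[OF flat_has_real_derivative] by (simp add: continuous_at_imp_continuous_on)
next
  case (Suc k)
  show ?case
  proof (rule C_k_on_SucI[OF open_UNIV])
    show "(flat n has_derivative (\<lambda>u. (flat (n + 2) x - real n * flat (n + 1) x) * u)) (at x)" for x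
      using flat_has_real_derivative[of n x] by (simp add: has_field_derivative_def)
    show "C_k_on k UNIV (\<lambda>x. (flat (n + 2) x - real n * flat (n + 1) x) * u)" for u
      by (intro C_k_on_mult C_k_on_diff C_k_on_const open_UNIV Suc.IH)
  qed
qed

lemma test_functionI:
  assumes "\<And>k. C_k_on k UNIV \<phi>" "compact K" "{x. \<phi> x \<noteq> 0} \<subseteq> K" "K \<subseteq> \<Omega>"
  shows "test_function \<Omega> \<phi>"
proof -
  have "closure {x. \<phi> x \<noteq> 0} \<subseteq> K"
    by (rule closure_minimal[OF assms(3) compact_imp_closed[OF assms(2)]])
  moreover have "compact (closure {x. \<phi> x \<noteq> 0})"
    using bounded_subset[OF compact_imp_bounded[OF assms(2)] assms(3)] by (simp add: compact_closure)
  ultimately show ?thesis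
    using assms by (auto simp: test_function_def smooth_on_def)
qed

text \<open>Compose \<open>flat 0\<close> with a quadratic polynomial that is positive exactly
  inside a ball around \<open>p\<close>.\<close>

lemma exists_bump:
  fixes p :: "'a::euclidean_space"
  assumes "open S" "p \<in> S"
  obtains \<phi> where "test_function S \<phi>" "\<And>x. \<phi> x \<ge> 0" "\<phi> p > 0"
proof -
  obtain e where e: "e > 0" "cball p e \<subseteq> S"
    using assms open_contains_cball by blast
  define \<phi> where "\<phi> x = flat 0 (e\<^sup>2 - (x - p) \<bullet> (x - p))" for x
  have "C_k_on k UNIV (\<lambda>x::'a. x \<bullet> x)" for k
  proof (cases k)
    case (Suc j)
    show ?thesis unfolding Suc
      by (rule C_k_on_SucI[where f' = "\<lambda>x u. 2 * (x \<bullet> u)"])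
         (auto intro!: derivative_eq_intros C_k_on_linear bounded_linear_const_mult
            bounded_linear_inner_right simp: inner_commute)
  qed (simp add: continuous_on_inner)
  \<comment> \<open>Expanding the squared distance leaves the square norm, a linear term and
    constants, each known to be smooth.\<close>
  then have "C_k_on k UNIV (\<lambda>x. e\<^sup>2 - (x \<bullet> x - 2 * (x \<bullet> p) + p \<bullet> p))" for k
    by (rule C_k_on_diff[OF open_UNIV C_k_on_const[OF open_UNIV] C_k_on_add[OF open_UNIV
          C_k_on_diff[OF open_UNIV _ C_k_on_linear[OF open_UNIV]] C_k_on_const[OF open_UNIV]]])
       (auto intro: bounded_linear_const_mult bounded_linear_inner_left)
  then have "C_k_on k UNIV (\<lambda>x. flat 0 (e\<^sup>2 - (x \<bullet> x - 2 * (x \<bullet> p) + p \<bullet> p)))" for k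
    by (rule C_k_on_compose_real[OF open_UNIV C_k_on_flat])
  moreover have "(x - p) \<bullet> (x - p) = x \<bullet> x - 2 * (x \<bullet> p) + p \<bullet> p" for x
    by (simp add: inner_diff_left inner_diff_right inner_commute[of p x])
  ultimately have "smooth_on UNIV \<phi>"
    unfolding smooth_on_def \<phi>_def by simp
  moreover have "{x. \<phi> x \<noteq> 0} \<subseteq> cball p e"
  proof
    fix x assume "x \<in> {x. \<phi> x \<noteq> 0}"
    then have "norm (x - p) ^ 2 < e ^ 2"
      by (auto simp: \<phi>_def flat_def dot_square_norm split: if_splits)
    then have "norm (x - p) < e"
      using e power2_less_imp_less by force
    then show "x \<in> cball p e"
      by (simp add: dist_norm norm_minus_commute)
  qed
  ultimately have "test_function S \<phi>"
    by (intro test_functionI[OF _ compact_cball _ e(2)]) (simp_all add: smooth_on_def)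
  then show thesis
    by (rule that) (use e in \<open>auto simp: \<phi>_def flat_def\<close>)
qed

section \<open>Gluing, extension by zero and compact supports\<close>

lemma C_k_on_Un:
  "open S \<Longrightarrow> open S' \<Longrightarrow> C_k_on k S f \<Longrightarrow> C_k_on k S' f \<Longrightarrow> C_k_on k (S \<union> S') f"
proof (induction k arbitrary: f)
  case 0
  then show ?case by (simp add: continuous_on_open_Un)
next
  case (Suc k)
  then have "C_k_on k (S \<union> S') (\<lambda>x. frechet_derivative f (at x) u)" for u by simp
  then show ?case using Suc.prems by auto
qed

text \<open>\<open>S\<close> and the complement of \<open>K\<close> are open sets covering the
  space, and \<open>f\<close> is zero on the second.\<close>

lemma C_k_on_extend_by_zero:
  assumes "open S" "compact K" "K \<subseteq> S" "C_k_on k S f" "\<And>x. x \<notin> K \<Longrightarrow> f x = 0"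
  shows "C_k_on k UNIV f"
proof -
  have "open (- K)" using assms(2) by (simp add: compact_imp_closed open_Compl)
  then have "C_k_on k (- K) f"
    using C_k_on_cong[OF _ _ C_k_on_const, of "- K" 0 f] assms(5) by simp
  then have "C_k_on k (S \<union> - K) f"
    by (rule C_k_on_Un[OF assms(1) \<open>open (- K)\<close> assms(4)])
  moreover have "S \<union> - K = UNIV" using assms(3) by auto
  ultimately show ?thesis by simp
qed

lemma frechet_derivative_eq_0_outside:
  assumes "closed K" "\<And>x. x \<notin> K \<Longrightarrow> f x = 0" "x \<notin> K"
  shows "frechet_derivative f (at x) u = 0"
proof -
  have "frechet_derivative (\<lambda>x. 0) (at x) = frechet_derivative f (at x)"
    by (rule frechet_derivative_transform_within_open[where X = "- K"]) (use assms in auto)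
  from this[symmetric] show ?thesis by simp
qed

lemma integrable_compact_support:
  fixes f :: "'a::euclidean_space \<Rightarrow> real"
  assumes "compact K" "continuous_on UNIV f" "\<And>x. x \<notin> K \<Longrightarrow> f x = 0"
  shows "integrable lborel f"
proof -
  have "(\<lambda>x. indicator K x *\<^sub>R f x) = f"
    using assms(3) by (auto simp: fun_eq_iff indicator_def)
  then show ?thesis
    using borel_integrable_compact[OF assms(1) continuous_on_subset[OF assms(2)]] by simp
qed

lemma test_function_mono: "test_function S \<phi> \<Longrightarrow> S \<subseteq> S' \<Longrightarrow> test_function S' \<phi>"
  by (auto simp: test_function_def)

lemma test_function_eq_0: "x \<notin> closure {x. \<phi> x \<noteq> 0} \<Longrightarrow> \<phi> x = (0::real)"
  using closure_subset[of "{x. \<phi> x \<noteq> 0}"] by blast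

lemma frechet_derivative_eq_0_off_support:
  fixes \<phi> :: "'a::euclidean_space \<Rightarrow> real"
  shows "x \<notin> closure {x. \<phi> x \<noteq> 0} \<Longrightarrow> frechet_derivative \<phi> (at x) u = 0"
  by (rule frechet_derivative_eq_0_outside[OF closed_closure test_function_eq_0])

lemma test_function_C_k_on: "test_function S \<phi> \<Longrightarrow> C_k_on k UNIV \<phi>"
  by (simp add: test_function_def smooth_on_def)

text \<open>If \<open>h p\<close> were nonzero, a bump at \<open>p\<close> supported where
  \<open>h\<close> has the sign of \<open>h p\<close> would give a nonzero integral.\<close>

lemma fundamental_lemma_calculus_of_variations:
  fixes h :: "'a::euclidean_space \<Rightarrow> real"
  assumes S: "open S" and h: "continuous_on S h"
    and int0: "\<And>\<phi>. test_function S \<phi> \<Longrightarrow> (LINT x|lborel. \<phi> x * h x) = 0"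
    and p: "p \<in> S"
  shows "h p = 0"
proof (rule ccontr)
  assume hp: "h p \<noteq> 0"
  \<comment> \<open>Multiplying by \<open>h p\<close> treats both signs at once.\<close>
  define U where "U = S \<inter> (\<lambda>x. h x * h p) -` {0<..}"
  have "open U"
    unfolding U_def by (intro continuous_open_preimage S continuous_intros h)
  moreover have "p \<in> U"
    using p hp by (simp add: U_def zero_less_mult_iff linorder_neq_iff disj_commute)
  ultimately obtain \<phi> where \<phi>: "test_function U \<phi>" "\<And>x. \<phi> x \<ge> 0" "\<phi> p > 0"
    using exists_bump by blast
  define K where "K = closure {x. \<phi> x \<noteq> 0}"
  have K: "compact K" "K \<subseteq> U"
    using \<phi>(1) by (auto simp: K_def test_function_def)
  have off: "\<phi> x = 0" if "x \<notin> K" for x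
    using that test_function_eq_0[of x \<phi>] by (simp add: K_def)
  have "U \<subseteq> S" by (auto simp: U_def)
  define f where "f x = \<phi> x * h x * h p" for x
  \<comment> \<open>\<open>h\<close> is controlled only on \<open>S\<close>; global continuity comes
    from extending the product by zero off \<open>K\<close>.\<close>
  have "C_k_on 0 S f"
    unfolding f_def C_k_on.simps(1)
    by (intro continuous_on_mult h continuous_on_const
        continuous_on_subset[OF C_k_on_imp_continuous_on[OF test_function_C_k_on[OF \<phi>(1)]]] subset_UNIV)
  then have "C_k_on 0 UNIV f"
    by (rule C_k_on_extend_by_zero[OF S K(1) order_trans[OF K(2) \<open>U \<subseteq> S\<close>]]) (simp add: f_def off)
  then have f_cont: "continuous_on UNIV f" by simp
  have f_int: "integrable lborel f"
    by (rule integrable_compact_support[OF K(1) f_cont]) (simp add: f_def off)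
  have "f x \<ge> 0" for x
  proof (cases "x \<in> K")
    case True
    then have "h x * h p > 0" using K by (auto simp: U_def)
    then show ?thesis using \<phi>(2)[of x] by (simp add: f_def mult.assoc)
  qed (simp add: f_def off)
  moreover have "(LINT x|lborel. f x) = 0"
    using int0[OF test_function_mono[OF \<phi>(1) \<open>U \<subseteq> S\<close>]] by (simp add: f_def)
  ultimately have AE: "AE x in lborel. f x = 0"
    using integral_nonneg_eq_0_iff_AE[OF f_int] by simp
  \<comment> \<open>An open null set is empty, whereas this one contains \<open>p\<close>.\<close>
  have N: "open {x. f x \<noteq> 0}"
    by (intro open_Collect_neq f_cont continuous_on_const)
  have "{x. f x \<noteq> 0} \<in> null_sets lborel"
    using AE by (subst AE_iff_null_sets) (simp_all add: N borel_open)
  then have "negligible {x. f x \<noteq> 0}"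
    by (simp add: negligible_iff_null_sets null_sets_completionI)
  moreover have "p \<in> {x. f x \<noteq> 0}"
    using hp \<phi>(3) by (simp add: f_def)
  ultimately show False
    using open_not_negligible[OF N] by blast
qed

section \<open>Integration by parts in the plane\<close>

lemma integral_real_derivative_eq_0:
  fixes F f :: "real \<Rightarrow> real"
  assumes "\<And>x. (F has_real_derivative f x) (at x)" "continuous_on UNIV f"
    and "\<And>x. \<bar>x\<bar> \<ge> b \<Longrightarrow> F x = 0" "\<And>x. \<bar>x\<bar> \<ge> b \<Longrightarrow> f x = 0"
  shows "(LINT x|lborel. f x) = 0"
proof -
  \<comment> \<open>The bound \<open>b\<close> may be negative; \<open>c\<close> makes
    \<open>{-c .. c}\<close> a proper interval of integration.\<close>
  define c where "c = max b 0"
  have "integral\<^sup>L lborel (\<lambda>x. indicator {-c .. c} x *\<^sub>R f x) = F c - F (- c)"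
    by (rule integral_FTC_atLeastAtMost)
       (use assms(1,2) in \<open>auto simp: c_def has_real_derivative_iff_has_vector_derivative[symmetric]
          intro: has_field_derivative_at_within continuous_on_subset\<close>)
  moreover have "(\<lambda>x. indicator {-c .. c} x *\<^sub>R f x) = f"
    by (rule ext, rule ccontr) (use assms(4) in \<open>force simp: indicator_def c_def\<close>)
  ultimately show ?thesis
    using assms(3)[of c] assms(3)[of "- c"] by (simp add: c_def)
qed

lemma has_derivative_partial_t:
  fixes g :: "real \<times> real \<Rightarrow> real"
  assumes "(g has_derivative g') (at (t, x))"
  shows "((\<lambda>s. g (s, x)) has_real_derivative g' (1, 0)) (at t)"
proof -
  have "((\<lambda>s. g (s, x)) has_derivative (\<lambda>h. g' (h, 0))) (at t)"
    by (rule has_derivative_compose[where f = "\<lambda>s. (s, x)" and g = g, OF _ assms, simplified])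
       (auto intro!: derivative_eq_intros)
  moreover have "(\<lambda>h. g' (h, 0)) = (*) (g' (1, 0))"
  proof
    show "g' (h, 0) = g' (1, 0) * h" for h
      using linear_scale[OF has_derivative_linear[OF assms], of h "(1, 0)"] by (simp add: mult.commute)
  qed
  ultimately show ?thesis
    unfolding has_field_derivative_def by (rule has_derivative_eq_rhs)
qed

lemma has_derivative_partial_x:
  fixes g :: "real \<times> real \<Rightarrow> real"
  assumes "(g has_derivative g') (at (t, x))"
  shows "((\<lambda>y. g (t, y)) has_real_derivative g' (0, 1)) (at x)"
proof -
  have "((\<lambda>y. g (t, y)) has_derivative (\<lambda>h. g' (0, h))) (at x)"
    by (rule has_derivative_compose[where f = "\<lambda>y. (t, y)" and g = g, OF _ assms, simplified])
       (auto intro!: derivative_eq_intros)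
  moreover have "(\<lambda>h. g' (0, h)) = (*) (g' (0, 1))"
  proof
    show "g' (0, h) = g' (0, 1) * h" for h
      using linear_scale[OF has_derivative_linear[OF assms], of h "(0, 1)"] by (simp add: mult.commute)
  qed
  ultimately show ?thesis
    unfolding has_field_derivative_def by (rule has_derivative_eq_rhs)
qed

lemma Dt_eq: "(g has_derivative g') (at p) \<Longrightarrow> Dt g p = g' (1, 0)"
  using has_derivative_partial_t[of g g' "fst p" "snd p", THEN DERIV_imp_deriv]
  by (simp add: Dt_def case_prod_beta)

lemma Dx_eq: "(g has_derivative g') (at p) \<Longrightarrow> Dx g p = g' (0, 1)"
  using has_derivative_partial_x[of g g' "fst p" "snd p", THEN DERIV_imp_deriv]
  by (simp add: Dx_def case_prod_beta)

lemma continuous_on_Dt: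
  assumes "C_k_on 1 S g" shows "continuous_on S (Dt g)"
proof -
  have "continuous_on S (\<lambda>p. frechet_derivative g (at p) (1, 0))"
    using assms by simp
  then show ?thesis
    by (rule continuous_on_eq)
       (use Dt_eq[OF C_k_on_Suc_has_derivative[OF assms[unfolded One_nat_def]]] in simp)
qed

lemma continuous_on_Dx:
  assumes "C_k_on 1 S g" shows "continuous_on S (Dx g)"
proof -
  have "continuous_on S (\<lambda>p. frechet_derivative g (at p) (0, 1))"
    using assms by simp
  then show ?thesis
    by (rule continuous_on_eq)
       (use Dx_eq[OF C_k_on_Suc_has_derivative[OF assms[unfolded One_nat_def]]] in simp)
qed

lemma Dt_Dx_eq_0_outside:
  assumes "closed K" "\<And>q. q \<notin> K \<Longrightarrow> g q = 0" "p \<notin> K"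
  shows "Dt g p = 0" "Dx g p = 0"
proof -
  have "((\<lambda>_. 0) has_derivative (\<lambda>_. 0)) (at p)" by simp
  then have "(g has_derivative (\<lambda>_. 0)) (at p)"
    by (rule has_derivative_transform_within_open[OF _ open_Compl[OF assms(1)]]) (use assms in auto)
  then show "Dt g p = 0" "Dx g p = 0"
    by (simp_all add: Dt_eq Dx_eq)
qed

lemma C_k_on_real_derivatives:
  assumes "C_k_on 1 UNIV g"
  shows "((\<lambda>s. g (s, x)) has_real_derivative Dt g (t, x)) (at t)"
    and "((\<lambda>y. g (t, y)) has_real_derivative Dx g (t, x)) (at x)"
proof -
  have d: "(g has_derivative frechet_derivative g (at (t, x))) (at (t, x))"
    by (rule C_k_on_Suc_has_derivative[of 0 UNIV]) (use assms in auto)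
  show "((\<lambda>s. g (s, x)) has_real_derivative Dt g (t, x)) (at t)"
    and "((\<lambda>y. g (t, y)) has_real_derivative Dx g (t, x)) (at x)"
    using has_derivative_partial_t[OF d] has_derivative_partial_x[OF d] Dt_eq[OF d] Dx_eq[OF d] by auto
qed

text \<open>By Fubini, integrate first in the variable of differentiation; the inner integral
  vanishes by the fundamental theorem of calculus.\<close>

lemma integral_Dt_Dx_eq_0:
  fixes g :: "real \<times> real \<Rightarrow> real"
  assumes g: "C_k_on 1 UNIV g" and K: "compact K" and off: "\<And>p. p \<notin> K \<Longrightarrow> g p = 0"
  shows "integrable lborel (Dt g)" "integrable lborel (Dx g)"
    and "(LINT p|lborel. Dt g p) = 0" "(LINT p|lborel. Dx g p) = 0"
proof -
  have off': "Dt g p = 0" "Dx g p = 0" if "p \<notin> K" for p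
    using Dt_Dx_eq_0_outside[OF compact_imp_closed[OF K]] off that by blast+
  note cont = continuous_on_Dt[OF g] continuous_on_Dx[OF g]
  show int: "integrable lborel (Dt g)" "integrable lborel (Dx g)"
    by (rule integrable_compact_support[OF K]; simp add: cont off')+
  obtain b where b: "\<And>p. p \<in> K \<Longrightarrow> norm p \<le> b"
    using compact_imp_bounded[OF K] unfolding bounded_iff by blast
  \<comment> \<open>The margin 1 is needed because points of norm \<open>b\<close> may still lie in
    \<open>K\<close>.\<close>
  have out: "(t, x) \<notin> K" if "\<bar>t\<bar> \<ge> b + 1 \<or> \<bar>x\<bar> \<ge> b + 1" for t x
    using b[of "(t, x)"] that norm_fst_le[of t x] norm_snd_le[of x t] by auto
  have t0: "(LINT t|lborel. Dt g (t, x)) = 0" for x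
    by (rule integral_real_derivative_eq_0[OF C_k_on_real_derivatives(1)[OF g], of _ "b + 1"])
       (auto simp: out off off' intro!: continuous_on_compose2[OF cont(1)] continuous_intros)
  have x0: "(LINT x|lborel. Dx g (t, x)) = 0" for t
    by (rule integral_real_derivative_eq_0[OF C_k_on_real_derivatives(2)[OF g], of _ "b + 1"])
       (auto simp: out off off' intro!: continuous_on_compose2[OF cont(2)] continuous_intros)
  show "(LINT p|lborel. Dt g p) = 0"
    using lborel_pair.integral_snd[of "\<lambda>t x. Dt g (t, x)"] int(1) t0 by (simp add: lborel_prod)
  show "(LINT p|lborel. Dx g p) = 0"
    using lborel_pair.integral_fst'[of "Dx g"] int(2) x0 by (simp add: lborel_prod)
qed

lemma open_strip: "open (strip T)"
  by (auto simp: strip_def intro: open_Times)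

lemma iterated_integral_strip:
  fixes G :: "real \<times> real \<Rightarrow> real"
  assumes "compact K" "K \<subseteq> strip T" "continuous_on UNIV G" "\<And>p. p \<notin> K \<Longrightarrow> G p = 0"
  shows "(LBINT t:{0<..<T}. LBINT x. G (t, x)) = (LINT p|lborel. G p)"
proof -
  have "G (t, x) = 0" if "t \<notin> {0<..<T}" for t x
    using assms(2) that by (intro assms(4)) (auto simp: strip_def)
  then have "indicator {0<..<T} t *\<^sub>R (LBINT x. G (t, x)) = (LBINT x. G (t, x))" for t
    by (cases "t \<in> {0<..<T}") simp_all
  then have "(LBINT t:{0<..<T}. LBINT x. G (t, x)) = (LBINT t. LBINT x. G (t, x))"
    unfolding set_lebesgue_integral_def by (simp only:)
  also have "\<dots> = (LINT p|lborel. G p)"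
    using lborel_pair.integral_fst'[of G] integrable_compact_support[OF assms(1,3,4)]
    by (simp add: lborel_prod)
  finally show ?thesis .
qed

section \<open>Residuals and the weak form\<close>

definition mass_residual :: "(real \<times> real \<Rightarrow> real) \<Rightarrow> (real \<times> real \<Rightarrow> real) \<Rightarrow> real \<times> real \<Rightarrow> real" where
  "mass_residual r w p = Dt r p + Dx (\<lambda>q. r q * w q) p"

text \<open>The non-conservative form: the momentum residual is \<open>w\<close> times the mass
  residual plus \<open>r\<close> times this one.\<close>

definition burgers_residual :: "(real \<times> real \<Rightarrow> real) \<Rightarrow> real \<times> real \<Rightarrow> real" where
  "burgers_residual w p = Dt w p + w p * Dx w p"

lemma C_1_has_derivative:
  "C_k_on 1 S f \<Longrightarrow> x \<in> S \<Longrightarrow> (f has_derivative frechet_derivative f (at x)) (at x)"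
  using C_k_on_Suc_has_derivative[of 0] by simp

text \<open>Translates between \<open>frechet_derivative\<close>, in which regularity is stated, and
  \<open>deriv\<close>, used for velocity test functions.\<close>

lemma C_1_deriv:
  assumes "C_k_on 1 UNIV \<psi>"
  shows "(\<psi> has_real_derivative deriv \<psi> \<xi>) (at \<xi>)"
    and "frechet_derivative \<psi> (at \<xi>) 1 = deriv \<psi> \<xi>"
proof -
  have "\<psi> differentiable (at \<xi>)"
    using assms by simp
  then obtain d where "(\<psi> has_real_derivative d) (at \<xi>)"
    by (auto simp: real_differentiable_def)
  then show d: "(\<psi> has_real_derivative deriv \<psi> \<xi>) (at \<xi>)"
    by (simp add: DERIV_imp_deriv)
  from frechet_derivative_at[OF d[unfolded has_field_derivative_def]]
  show "frechet_derivative \<psi> (at \<xi>) 1 = deriv \<psi> \<xi>"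
    by (metis mult.right_neutral)
qed

text \<open>Differentiating the flux as \<open>(r w) w^k\<close> lets the mass residual appear as
  the coefficient of \<open>w^k\<close>. At \<open>k = 0\<close> the truncated exponent
  \<open>k - 1\<close> is harmless because of the factor \<open>real k\<close>.\<close>

lemma moment_flux:
  assumes "C_k_on 1 S r" "C_k_on 1 S w" "p \<in> S"
  shows "Dt (\<lambda>q. r q * w q ^ k) p + Dx (\<lambda>q. r q * w q ^ (k + 1)) p =
    w p ^ k * mass_residual r w p + real k * w p ^ (k - 1) * (r p * burgers_residual w p)"
proof -
  note r = C_1_has_derivative[OF assms(1,3)] and w = C_1_has_derivative[OF assms(2,3)]
  note rw = has_derivative_mult[OF r w]
  have "Dt (\<lambda>q. r q * w q ^ k) p = r p * (real k * Dt w p * w p ^ (k - 1)) + Dt r p * w p ^ k"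
    using Dt_eq[OF has_derivative_mult[OF r has_derivative_power[OF w]]] Dt_eq[OF r] Dt_eq[OF w] by simp
  moreover have "Dx (\<lambda>q. (r q * w q) * w q ^ k) p =
      (r p * w p) * (real k * Dx w p * w p ^ (k - 1)) + Dx (\<lambda>q. r q * w q) p * w p ^ k"
    using Dx_eq[OF has_derivative_mult[OF rw has_derivative_power[OF w]]] Dx_eq[OF rw] Dx_eq[OF w] by simp
  ultimately show ?thesis
    by (simp add: mass_residual_def burgers_residual_def algebra_simps)
qed

lemma hermite_moments_nonsingular:
  fixes a b m n m' n' :: real
  assumes "a \<noteq> b" and E: "\<And>k. k \<le> 3 \<Longrightarrow>
    (a ^ k * m + real k * a ^ (k - 1) * n) + (b ^ k * m' + real k * b ^ (k - 1) * n') = 0"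
  shows "m = 0 \<and> n = 0"
proof -
  define e where "e k = (a ^ k * m + real k * a ^ (k - 1) * n) + (b ^ k * m' + real k * b ^ (k - 1) * n')" for k
  have "e k = 0" if "k \<le> 3" for k
    unfolding e_def by (rule E[OF that])
  then have "e 0 = 0" "e 1 = 0" "e 2 = 0" "e 3 = 0"
    by simp_all
  \<comment> \<open>The coefficients are those of \<open>(\<xi> - a)(\<xi> - b)^2\<close>, which
    vanishes at \<open>a\<close> and doubly at \<open>b\<close>, with derivative
    \<open>(a - b)^2\<close> at \<open>a\<close>.\<close>
  moreover have "(a - b)\<^sup>2 * n = e 3 - (2 * b + a) * e 2 + (b\<^sup>2 + 2 * a * b) * e 1 - a * b\<^sup>2 * e 0"
    by (simp add: e_def power2_eq_square power3_eq_cube algebra_simps)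
  ultimately have n: "n = 0" using assms(1) by simp
  \<comment> \<open>The same with \<open>(\<xi> - b)^2\<close>, which removes the node
    \<open>b\<close> and leaves \<open>m\<close> once \<open>n\<close> is known.\<close>
  have "(a - b)\<^sup>2 * m + 2 * (a - b) * n = e 2 - 2 * b * e 1 + b\<^sup>2 * e 0"
    by (simp add: e_def power2_eq_square algebra_simps)
  then have "m = 0"
    using n assms(1) \<open>e 0 = 0\<close> \<open>e 1 = 0\<close> \<open>e 2 = 0\<close> by simp
  with n show ?thesis by simp
qed

section \<open>Test functions in three variables and their traces on velocity graphs\<close>

lemma frechet_derivative_expand:
  fixes \<Phi> :: "real \<times> real \<times> real \<Rightarrow> real"
  assumes "C_k_on 1 UNIV \<Phi>"
  shows "frechet_derivative \<Phi> (at q) (a, b, c) = a * frechet_derivative \<Phi> (at q) (1, 0, 0) +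
    b * frechet_derivative \<Phi> (at q) (0, 1, 0) + c * frechet_derivative \<Phi> (at q) (0, 0, 1)"
proof -
  let ?D = "frechet_derivative \<Phi> (at q)"
  have lin: "linear ?D"
    using C_1_has_derivative[OF assms UNIV_I] by (rule has_derivative_linear)
  have "?D (a, b, c) = ?D (a *\<^sub>R (1, 0, 0) + b *\<^sub>R (0, 1, 0) + c *\<^sub>R (0, 0, 1))"
    by simp
  also have "\<dots> = a * ?D (1, 0, 0) + b * ?D (0, 1, 0) + c * ?D (0, 0, 1)"
    by (simp only: linear_add[OF lin] linear_scale[OF lin] real_scaleR_def)
  finally show ?thesis .
qed

text \<open>The chain rule for affine embeddings expresses the derivatives in the transport equation
  through the full derivative of \<open>\<Phi>\<close>.\<close>

lemma slice_derivatives: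
  fixes \<Phi> :: "real \<times> real \<times> real \<Rightarrow> real"
  assumes "C_k_on 1 UNIV \<Phi>"
  shows "Dt (\<lambda>(s, y). \<Phi> (s, y, \<xi>)) (t, x) = frechet_derivative \<Phi> (at (t, x, \<xi>)) (1, 0, 0)"
    and "Dx (\<lambda>(s, y). \<Phi> (s, y, \<xi>)) (t, x) = frechet_derivative \<Phi> (at (t, x, \<xi>)) (0, 1, 0)"
    and "((\<lambda>\<zeta>. \<Phi> (t, x, \<zeta>)) has_real_derivative frechet_derivative \<Phi> (at (t, x, \<xi>)) (0, 0, 1)) (at \<xi>)"
proof -
  let ?D = "frechet_derivative \<Phi> (at (t, x, \<xi>))"
  have D: "(\<Phi> has_derivative ?D) (at (t, x, \<xi>))"
    using C_1_has_derivative[OF assms UNIV_I] .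
  have "((\<lambda>p. (fst p, snd p, \<xi>)) has_derivative (\<lambda>u. (fst u, snd u, 0))) (at (t, x))"
    by (auto intro!: derivative_eq_intros)
  from has_derivative_compose[OF this, of \<Phi> ?D] D
  have "((\<lambda>p. \<Phi> (fst p, snd p, \<xi>)) has_derivative (\<lambda>u. ?D (fst u, snd u, 0))) (at (t, x))"
    by simp
  from Dt_eq[OF this] Dx_eq[OF this]
  show "Dt (\<lambda>(s, y). \<Phi> (s, y, \<xi>)) (t, x) = ?D (1, 0, 0)"
    and "Dx (\<lambda>(s, y). \<Phi> (s, y, \<xi>)) (t, x) = ?D (0, 1, 0)"
    by (simp_all add: case_prod_unfold)
  have "((\<lambda>\<zeta>. (t, x, \<zeta>)) has_derivative (\<lambda>h. (0, 0, h))) (at \<xi>)"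
    by (auto intro!: derivative_eq_intros)
  from has_derivative_compose[OF this, of \<Phi> ?D] D
  have "((\<lambda>\<zeta>. \<Phi> (t, x, \<zeta>)) has_derivative (\<lambda>h. ?D (0, 0, h))) (at \<xi>)"
    by simp
  moreover have "(\<lambda>h. ?D (0, 0, h)) = (*) (?D (0, 0, 1))"
  proof
    show "?D (0, 0, h) = ?D (0, 0, 1) * h" for h
      using frechet_derivative_expand[OF assms, of "(t, x, \<xi>)" 0 0 h] by simp
  qed
  ultimately show "((\<lambda>\<zeta>. \<Phi> (t, x, \<zeta>)) has_real_derivative ?D (0, 0, 1)) (at \<xi>)"
    unfolding has_field_derivative_def by (rule has_derivative_eq_rhs)
qed

lemma trace_derivative:
  fixes \<Phi> :: "real \<times> real \<times> real \<Rightarrow> real" and w :: "real \<times> real \<Rightarrow> real"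
  assumes \<Phi>: "C_k_on 1 UNIV \<Phi>" and w: "C_k_on 1 S w" and p: "p \<in> S"
  shows "((\<lambda>p. \<Phi> (fst p, snd p, w p)) has_derivative
    (\<lambda>u. frechet_derivative \<Phi> (at (fst p, snd p, w p)) (fst u, snd u, frechet_derivative w (at p) u))) (at p)"
proof -
  have "((\<lambda>p. (fst p, snd p, w p)) has_derivative (\<lambda>u. (fst u, snd u, frechet_derivative w (at p) u))) (at p)"
    by (intro has_derivative_Pair C_1_has_derivative[OF w p] has_derivative_fst has_derivative_snd
        has_derivative_ident)
  from has_derivative_compose[OF this C_1_has_derivative[OF \<Phi> UNIV_I]] show ?thesis .
qed

lemma continuous_on_trace:
  fixes \<Psi> :: "real \<times> real \<times> real \<Rightarrow> real"
  assumes "continuous_on UNIV \<Psi>" "C_k_on 1 S w"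
  shows "continuous_on S (\<lambda>p. \<Psi> (fst p, snd p, w p))"
  by (rule continuous_on_compose2[OF assms(1)])
     (intro continuous_on_Pair continuous_on_fst continuous_on_snd continuous_on_id
        C_k_on_imp_continuous_on[OF assms(2)], simp)

lemma continuous_on_frechet_derivative:
  "C_k_on 1 S f \<Longrightarrow> continuous_on S (\<lambda>x. frechet_derivative f (at x) u)"
  by simp

lemma C_k_on_trace:
  fixes \<Phi> :: "real \<times> real \<times> real \<Rightarrow> real" and w :: "real \<times> real \<Rightarrow> real"
  assumes \<Phi>: "C_k_on 1 UNIV \<Phi>" and w: "C_k_on 1 S w" and S: "open S"
  shows "C_k_on 1 S (\<lambda>p. \<Phi> (fst p, snd p, w p))"
  unfolding One_nat_def
proof (rule C_k_on_SucI[OF S trace_derivative[OF \<Phi> w]])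
  fix u
  show "C_k_on 0 S (\<lambda>p. frechet_derivative \<Phi> (at (fst p, snd p, w p))
      (fst u, snd u, frechet_derivative w (at p) u))"
    \<comment> \<open>The direction varies with \<open>p\<close>, while \<open>C_k_on\<close> gives
      continuity for fixed directions; expanding in the basis separates the two.\<close>
    unfolding frechet_derivative_expand[OF \<Phi>, of _ "fst u" "snd u"] C_k_on.simps(1)
    by (intro continuous_on_add continuous_on_mult continuous_on_const
        continuous_on_trace[OF continuous_on_frechet_derivative[OF \<Phi>] w]
        continuous_on_frechet_derivative[OF w])
qed

text \<open>Integration by parts for one component. \<open>K\<close> is the projection of the
  support of \<open>\<Phi>\<close> to the \<open>(t,x)\<close> plane. \<open>G + R\<close> equals
  the divergence of the trace of \<open>\<Phi>\<close> times \<open>(r, r w)\<close>, whose integral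
  is zero.\<close>

lemma transport_pairing:
  fixes r w :: "real \<times> real \<Rightarrow> real" and \<Phi> :: "real \<times> real \<times> real \<Rightarrow> real"
  defines "D \<equiv> \<lambda>p u. frechet_derivative \<Phi> (at (fst p, snd p, w p)) u"
  defines "K \<equiv> (\<lambda>q. (fst q, fst (snd q))) ` closure {q. \<Phi> q \<noteq> 0}"
  defines "G \<equiv> \<lambda>p. r p * (D p (1, 0, 0) + w p * D p (0, 1, 0))"
  defines "R \<equiv> \<lambda>p. \<Phi> (fst p, snd p, w p) * mass_residual r w p +
    D p (0, 0, 1) * (r p * burgers_residual w p)"
  assumes r: "C_k_on 1 (strip T) r" and w: "C_k_on 1 (strip T) w"
    and \<Phi>: "test_function ({0<..<T} \<times> UNIV \<times> UNIV) \<Phi>"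
  shows "compact K" "K \<subseteq> strip T" "continuous_on UNIV G" "\<And>p. p \<notin> K \<Longrightarrow> G p = 0"
    and "integrable lborel G" "integrable lborel R" "(LINT p|lborel. G p) = - (LINT p|lborel. R p)"
proof -
  let ?S = "strip T"
  have \<Phi>1: "C_k_on 1 UNIV \<Phi>" using test_function_C_k_on[OF \<Phi>] .
  show K: "compact K"
    unfolding K_def using \<Phi>
    by (intro compact_continuous_image continuous_intros) (simp add: test_function_def)
  show KS: "K \<subseteq> ?S"
    using \<Phi> by (fastforce simp: K_def test_function_def strip_def)
  have out: "(fst p, snd p, \<xi>) \<notin> closure {q. \<Phi> q \<noteq> 0}" if "p \<notin> K" for p \<xi>
    using that by (force simp: K_def image_iff)
  have off: "\<Phi> (fst p, snd p, w p) = 0" "D p u = 0" if "p \<notin> K" for p u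
    using test_function_eq_0[OF out[OF that]]
      frechet_derivative_eq_0_off_support[OF out[OF that]]
    by (simp_all add: D_def)
  show Goff: "G p = 0" if "p \<notin> K" for p by (simp add: G_def off[OF that])
  have Roff: "R p = 0" if "p \<notin> K" for p by (simp add: R_def off[OF that])
  define \<psi> where "\<psi> p = \<Phi> (fst p, snd p, w p)" for p
  have \<psi>: "C_k_on 1 ?S \<psi>"
    unfolding \<psi>_def by (rule C_k_on_trace[OF \<Phi>1 w open_strip])
  have rw: "C_k_on 1 ?S (\<lambda>p. r p * w p)"
    by (rule C_k_on_mult[OF open_strip r w])
  define A where "A p = r p * \<psi> p" for p
  define B where "B p = (r p * w p) * \<psi> p" for p
  have AB: "C_k_on 1 ?S A" "C_k_on 1 ?S B"
    unfolding A_def B_def by (intro C_k_on_mult open_strip r rw \<psi>)+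
  have ABoff: "A p = 0" "B p = 0" if "p \<notin> K" for p
    using off(1)[OF that] by (simp_all add: A_def B_def \<psi>_def)
  have A1: "C_k_on 1 UNIV A"
    by (rule C_k_on_extend_by_zero[OF open_strip K KS AB(1) ABoff(1)])
  have B1: "C_k_on 1 UNIV B"
    by (rule C_k_on_extend_by_zero[OF open_strip K KS AB(2) ABoff(2)])
  have eq: "G p = Dt A p + Dx B p - R p" for p
  \<comment> \<open>On \<open>K\<close>, inside the strip, product and chain rules apply; off
    \<open>K\<close> every term vanishes, whatever \<open>r\<close> and \<open>w\<close> are
    there.\<close>
  proof (cases "p \<in> K")
    case True
    then have p: "p \<in> ?S" using KS by blast
    note dr = C_1_has_derivative[OF r p] and dw = C_1_has_derivative[OF w p]
      and drw = C_1_has_derivative[OF rw p]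
    note d\<psi> = trace_derivative[OF \<Phi>1 w p, folded \<psi>_def D_def]
    have "Dt A p = r p * D p (1, 0, Dt w p) + Dt r p * \<psi> p"
      using Dt_eq[OF has_derivative_mult[OF dr d\<psi>]] Dt_eq[OF dr] Dt_eq[OF dw]
      by (simp add: A_def[abs_def] D_def)
    moreover have "Dx B p = (r p * w p) * D p (0, 1, Dx w p) + Dx (\<lambda>q. r q * w q) p * \<psi> p"
      using Dx_eq[OF has_derivative_mult[OF drw d\<psi>]] Dx_eq[OF drw] Dx_eq[OF dw]
      by (simp add: B_def[abs_def] D_def)
    \<comment> \<open>The \<open>\<xi>\<close>-derivative terms, weighted by \<open>r\<close> and
      \<open>r w\<close>, combine into \<open>r\<close> times the Burgers residual.\<close>
    moreover have "D p (1, 0, Dt w p) = D p (1, 0, 0) + Dt w p * D p (0, 0, 1)"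
      "D p (0, 1, Dx w p) = D p (0, 1, 0) + Dx w p * D p (0, 0, 1)"
      using frechet_derivative_expand[OF \<Phi>1, of _ 1 0 "Dt w p"]
        frechet_derivative_expand[OF \<Phi>1, of _ 0 1 "Dx w p"] by (simp_all add: D_def)
    ultimately show ?thesis
      by (simp add: G_def R_def \<psi>_def[symmetric] mass_residual_def burgers_residual_def algebra_simps)
  next
    case False
    then show ?thesis
      using Dt_Dx_eq_0_outside[OF compact_imp_closed[OF K], of A p]
        Dt_Dx_eq_0_outside[OF compact_imp_closed[OF K], of B p]
      by (simp add: ABoff Goff Roff)
  qed
  have contD: "continuous_on ?S (\<lambda>p. D p u)" for u
    unfolding D_def by (rule continuous_on_trace[OF continuous_on_frechet_derivative[OF \<Phi>1] w])
  note cont = C_k_on_imp_continuous_on[OF r] C_k_on_imp_continuous_on[OF w] contD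
    continuous_on_Dt[OF r] continuous_on_Dt[OF w] continuous_on_Dx[OF w] continuous_on_Dx[OF rw]
    C_k_on_imp_continuous_on[OF \<psi>, unfolded \<psi>_def]
  have "C_k_on 0 ?S G" "C_k_on 0 ?S R"
    unfolding G_def R_def mass_residual_def burgers_residual_def C_k_on.simps(1)
    by (intro continuous_on_add continuous_on_mult cont)+
  from C_k_on_extend_by_zero[OF open_strip K KS this(1) Goff]
    C_k_on_extend_by_zero[OF open_strip K KS this(2) Roff]
  have G_cont: "continuous_on UNIV G" and R_cont: "continuous_on UNIV R" by simp_all
  show "continuous_on UNIV G" by (rule G_cont)
  show "integrable lborel G" and R: "integrable lborel R"
    using integrable_compact_support[OF K G_cont Goff] integrable_compact_support[OF K R_cont Roff]
    by simp_all
  have "(LINT p|lborel. G p) = (LINT p|lborel. Dt A p + Dx B p - R p)"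
    by (simp only: eq)
  also have "\<dots> = - (LINT p|lborel. R p)"
    using integral_Dt_Dx_eq_0[OF A1 K ABoff(1)] integral_Dt_Dx_eq_0[OF B1 K ABoff(2)] R
    by simp
  finally show "(LINT p|lborel. G p) = - (LINT p|lborel. R p)" .
qed

lemma free_transport_pairing:
  fixes \<rho> v :: "nat \<Rightarrow> real \<times> real \<Rightarrow> real" and \<Phi> :: "real \<times> real \<times> real \<Rightarrow> real"
  assumes \<rho>: "\<forall>i\<in>{1, 2}. C_k_on 1 (strip T) (\<rho> i)"
    and v: "\<forall>i\<in>{1, 2}. C_k_on 1 (strip T) (v i)"
    and \<Phi>: "test_function ({0<..<T} \<times> UNIV \<times> UNIV) \<Phi>"
  shows "(LBINT t:{0<..<T}. LBINT x. two_node_density \<rho> v (t, x)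
      (\<lambda>\<xi>. Dt (\<lambda>(s, y). \<Phi> (s, y, \<xi>)) (t, x) + \<xi> * Dx (\<lambda>(s, y). \<Phi> (s, y, \<xi>)) (t, x))) =
    - (LINT p|lborel. (\<Sum>i\<in>{1, 2}. \<Phi> (fst p, snd p, v i p) * mass_residual (\<rho> i) (v i) p +
        frechet_derivative \<Phi> (at (fst p, snd p, v i p)) (0, 0, 1) *
        (\<rho> i p * burgers_residual (v i) p)))"
    (is "?lhs = - (LINT p|lborel. (\<Sum>i\<in>_. ?R i p))")
proof -
  define G where "G i p = \<rho> i p * (frechet_derivative \<Phi> (at (fst p, snd p, v i p)) (1, 0, 0) +
    v i p * frechet_derivative \<Phi> (at (fst p, snd p, v i p)) (0, 1, 0))" for i p
  have I: "1 \<in> {1, 2::nat}" "2 \<in> {1, 2::nat}" by auto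
  note tp1 = transport_pairing[OF bspec[OF \<rho> I(1)] bspec[OF v I(1)] \<Phi>, folded G_def]
    and tp2 = transport_pairing[OF bspec[OF \<rho> I(2)] bspec[OF v I(2)] \<Phi>, folded G_def]
  \<comment> \<open>The Dirac masses evaluate at \<open>\<xi> = v i (t, x)\<close>, turning the
    slice derivatives into the integrands \<open>G i\<close>.\<close>
  have "two_node_density \<rho> v (t, x)
      (\<lambda>\<xi>. Dt (\<lambda>(s, y). \<Phi> (s, y, \<xi>)) (t, x) + \<xi> * Dx (\<lambda>(s, y). \<Phi> (s, y, \<xi>)) (t, x)) =
      G 1 (t, x) + G 2 (t, x)" for t x
    using slice_derivatives(1,2)[OF test_function_C_k_on[OF \<Phi>]]
    by (simp add: two_node_density_def dirac_def G_def)
  then have "?lhs = (LBINT t:{0<..<T}. LBINT x. (\<lambda>p. G 1 p + G 2 p) (t, x))"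
    by simp
  also have "\<dots> = (LINT p|lborel. G 1 p + G 2 p)"
    by (rule iterated_integral_strip[OF tp1(1,2) continuous_on_add[OF tp1(3) tp2(3)]])
       (simp only: tp1(4) tp2(4) add_0 simp_thms)
  also have "\<dots> = (LINT p|lborel. G 1 p) + (LINT p|lborel. G 2 p)"
    by (rule Bochner_Integration.integral_add[OF tp1(5) tp2(5)])
  also have "\<dots> = - (LINT p|lborel. ?R 1 p) - (LINT p|lborel. ?R 2 p)"
    by (simp only: tp1(7) tp2(7) diff_conv_add_uminus)
  also have "\<dots> = - (LINT p|lborel. (\<Sum>i\<in>{1, 2}. ?R i p))"
    using Bochner_Integration.integral_add[OF tp1(6) tp2(6)] by simp
  finally show ?thesis .
qed

section \<open>Product test functions and separation of the two nodes\<close>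

lemma test_function_tensor:
  fixes \<phi> :: "real \<times> real \<Rightarrow> real" and \<psi> :: "real \<Rightarrow> real"
  assumes \<phi>: "test_function (strip T) \<phi>" and \<psi>: "test_function UNIV \<psi>"
  shows "test_function ({0<..<T} \<times> UNIV \<times> UNIV) (\<lambda>q. \<phi> (fst q, fst (snd q)) * \<psi> (snd (snd q)))"
    (is "test_function _ ?\<Phi>")
proof -
  have "bounded_linear (\<lambda>q::real \<times> real \<times> real. (fst q, fst (snd q)))"
    and "bounded_linear (\<lambda>q::real \<times> real \<times> real. snd (snd q))"
    by (intro bounded_linear_Pair bounded_linear_fst bounded_linear_fst_comp bounded_linear_snd_comp
        bounded_linear_snd)+
  then have smooth: "C_k_on k UNIV ?\<Phi>" for k
    by (intro C_k_on_mult[OF open_UNIV] C_k_on_compose_linear[OF _ test_function_C_k_on[OF \<phi>]]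
        C_k_on_compose_linear[OF _ test_function_C_k_on[OF \<psi>]])
  \<comment> \<open>The product of the two supports, reassociated from \<open>((t,x),\<xi>)\<close>
    to \<open>(t,x,\<xi>)\<close>.\<close>
  define C where "C = (\<lambda>z. (fst (fst z), snd (fst z), snd z)) `
    (closure {p. \<phi> p \<noteq> 0} \<times> closure {\<xi>. \<psi> \<xi> \<noteq> 0})"
  have "compact C"
    unfolding C_def using \<phi> \<psi>
    by (intro compact_continuous_image compact_Times continuous_intros) (simp_all add: test_function_def)
  moreover have "{q. ?\<Phi> q \<noteq> 0} \<subseteq> C"
  proof
    fix q assume "q \<in> {q. ?\<Phi> q \<noteq> 0}"
    then have "(fst q, fst (snd q)) \<in> closure {p. \<phi> p \<noteq> 0}" "snd (snd q) \<in> closure {\<xi>. \<psi> \<xi> \<noteq> 0}"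
      using test_function_eq_0[of "(fst q, fst (snd q))" \<phi>] test_function_eq_0[of "snd (snd q)" \<psi>] by auto
    then show "q \<in> C"
      unfolding C_def by (intro image_eqI[of _ _ "((fst q, fst (snd q)), snd (snd q))"]) auto
  qed
  moreover have "C \<subseteq> {0<..<T} \<times> UNIV \<times> UNIV"
    using \<phi> by (force simp: C_def test_function_def strip_def)
  ultimately show ?thesis
    by (intro test_functionI[OF smooth \<open>compact C\<close>])
qed

lemma tensor_derivatives:
  fixes \<phi> :: "real \<times> real \<Rightarrow> real" and \<psi> :: "real \<Rightarrow> real" and T t x \<xi> :: real
  defines "\<Phi> \<equiv> \<lambda>q. \<phi> (fst q, fst (snd q)) * \<psi> (snd (snd q))"
  assumes \<phi>: "test_function (strip T) \<phi>" and \<psi>: "test_function UNIV \<psi>"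
  shows "Dt (\<lambda>(s, y). \<Phi> (s, y, \<xi>)) (t, x) = Dt \<phi> (t, x) * \<psi> \<xi>"
    and "Dx (\<lambda>(s, y). \<Phi> (s, y, \<xi>)) (t, x) = Dx \<phi> (t, x) * \<psi> \<xi>"
    and "frechet_derivative \<Phi> (at (t, x, \<xi>)) (0, 0, 1) = \<phi> (t, x) * deriv \<psi> \<xi>"
proof -
  note D = C_k_on_real_derivatives[OF test_function_C_k_on[OF \<phi>]]
  show "Dt (\<lambda>(s, y). \<Phi> (s, y, \<xi>)) (t, x) = Dt \<phi> (t, x) * \<psi> \<xi>"
    using DERIV_imp_deriv[OF DERIV_cmult_right[OF D(1)]] by (simp add: \<Phi>_def Dt_def[of "case_prod _"])
  show "Dx (\<lambda>(s, y). \<Phi> (s, y, \<xi>)) (t, x) = Dx \<phi> (t, x) * \<psi> \<xi>"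
    using DERIV_imp_deriv[OF DERIV_cmult_right[OF D(2)]] by (simp add: \<Phi>_def Dx_def[of "case_prod _"])
  have "(\<psi> has_real_derivative deriv \<psi> \<xi>) (at \<xi>)"
    by (rule C_1_deriv(1)[OF test_function_C_k_on[OF \<psi>]])
  then have "((\<lambda>\<zeta>. \<Phi> (t, x, \<zeta>)) has_real_derivative \<phi> (t, x) * deriv \<psi> \<xi>) (at \<xi>)"
    by (simp add: \<Phi>_def DERIV_cmult)
  moreover have "C_k_on 1 UNIV \<Phi>"
    unfolding \<Phi>_def by (rule test_function_C_k_on[OF test_function_tensor[OF \<phi> \<psi>]])
  ultimately show "frechet_derivative \<Phi> (at (t, x, \<xi>)) (0, 0, 1) = \<phi> (t, x) * deriv \<psi> \<xi>"
    using slice_derivatives(3) DERIV_unique by metis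
qed

text \<open>
  Take a bump \<open>\<beta>\<close> at \<open>a\<close> supported away from \<open>b\<close>: \<open>(\<xi> - a)\<beta>\<close> isolates \<open>n\<close>, and then \<open>\<beta>\<close> isolates \<open>m\<close>.
\<close>

lemma test_functions_separate_jets:
  fixes a b m n m' n' :: real
  assumes "a \<noteq> b" and E: "\<And>\<psi>. test_function UNIV \<psi> \<Longrightarrow>
    (\<psi> a * m + deriv \<psi> a * n) + (\<psi> b * m' + deriv \<psi> b * n') = 0"
  shows "m = 0 \<and> n = 0"
proof -
  obtain \<beta> where \<beta>: "test_function (- {b}) \<beta>" "\<beta> a > 0"
    using exists_bump[of "- {b}" a] assms(1) by auto
  define \<gamma> where "\<gamma> \<xi> = (\<xi> - a) * \<beta> \<xi>" for \<xi>
  have smooth: "C_k_on k UNIV \<gamma>" for k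
    unfolding \<gamma>_def
    by (intro C_k_on_mult[OF open_UNIV] C_k_on_diff[OF open_UNIV] C_k_on_const[OF open_UNIV]
        C_k_on_linear[OF open_UNIV bounded_linear_ident] test_function_C_k_on[OF \<beta>(1)])
  have \<gamma>: "test_function (- {b}) \<gamma>"
  proof (rule test_functionI[OF smooth])
    show "{\<xi>. \<gamma> \<xi> \<noteq> 0} \<subseteq> closure {\<xi>. \<beta> \<xi> \<noteq> 0}"
      using closure_subset[of "{\<xi>. \<beta> \<xi> \<noteq> 0}"] by (auto simp: \<gamma>_def)
  qed (use \<beta>(1) in \<open>simp_all add: test_function_def\<close>)
  \<comment> \<open>The support is closed and misses \<open>b\<close>, so \<open>\<psi>\<close> is
    zero on a whole neighbourhood of \<open>b\<close>.\<close>
  have vanish: "\<psi> b = 0 \<and> deriv \<psi> b = 0" if "test_function (- {b}) \<psi>" for \<psi>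
  proof -
    let ?K = "closure {\<xi>. \<psi> \<xi> \<noteq> 0}"
    have b: "b \<in> - ?K" using that by (auto simp: test_function_def)
    have "((\<lambda>_. 0) has_real_derivative 0) (at b)" by simp
    then have "(\<psi> has_real_derivative 0) (at b)"
    proof (rule has_field_derivative_transform_within_open[OF _ open_Compl[OF closed_closure] b])
      show "0 = \<psi> x" if "x \<in> - ?K" for x
        using test_function_eq_0[of x \<psi>] that by simp
    qed
    then show ?thesis
      using test_function_eq_0[of b \<psi>] b by (simp add: DERIV_imp_deriv)
  qed
  have "(\<beta> has_real_derivative deriv \<beta> a) (at a)"
    by (rule C_1_deriv(1)[OF test_function_C_k_on[OF \<beta>(1)]])
  then have "(\<gamma> has_real_derivative \<beta> a) (at a)"
    unfolding \<gamma>_def by (auto intro!: derivative_eq_intros)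
  then have "deriv \<gamma> a = \<beta> a" "\<gamma> a = 0"
    by (simp_all add: DERIV_imp_deriv \<gamma>_def)
  with E[OF test_function_mono[OF \<gamma>]] vanish[OF \<gamma>] \<beta>(2) have "n = 0" by simp
  moreover with E[OF test_function_mono[OF \<beta>(1)]] vanish[OF \<beta>(1)] \<beta>(2) have "m = 0" by simp
  ultimately show ?thesis by simp
qed

lemma Dt_Dx_add:
  assumes "C_k_on 1 S f" "C_k_on 1 S g" "p \<in> S"
  shows "Dt (\<lambda>q. f q + g q) p = Dt f p + Dt g p" "Dx (\<lambda>q. f q + g q) p = Dx f p + Dx g p"
proof -
  note f = C_1_has_derivative[OF assms(1,3)] and g = C_1_has_derivative[OF assms(2,3)]
  show "Dt (\<lambda>q. f q + g q) p = Dt f p + Dt g p" "Dx (\<lambda>q. f q + g q) p = Dx f p + Dx g p"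
    using Dt_eq[OF f] Dt_eq[OF g] Dt_eq[OF has_derivative_add[OF f g]]
      Dx_eq[OF f] Dx_eq[OF g] Dx_eq[OF has_derivative_add[OF f g]] by simp_all
qed

section \<open>Equivalence of the moment, pressureless and transport formulations\<close>

theorem proposition4p1:
  fixes T :: real and \<rho> v :: "nat \<Rightarrow> real \<times> real \<Rightarrow> real"
  assumes "T > 0"
    and "\<And>i. i \<in> {1, 2} \<Longrightarrow> C_k_on 1 (strip T) (\<rho> i)"
    and "\<And>i. i \<in> {1, 2} \<Longrightarrow> C_k_on 1 (strip T) (v i)"
    and "\<And>p. p \<in> strip T \<Longrightarrow> \<rho> 1 p > 0"
    and "\<And>p. p \<in> strip T \<Longrightarrow> \<rho> 2 p > 0"
    and "\<And>p. p \<in> strip T \<Longrightarrow> v 1 p > v 2 p"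
  shows "(four_moment_system T \<rho> v \<longleftrightarrow> pressureless_systems T \<rho> v) \<and>
    (four_moment_system T \<rho> v \<longleftrightarrow> free_transport_distributional T (two_node_density \<rho> v)) \<and>
    (free_transport_distributional T (two_node_density \<rho> v) \<longleftrightarrow>
      (\<forall>\<phi> :: real \<times> real \<Rightarrow> real. \<forall>\<psi> :: real \<Rightarrow> real.
         test_function (strip T) \<phi> \<longrightarrow> test_function UNIV \<psi> \<longrightarrow>
         (LBINT t:{0<..<T}. LBINT x.
            (\<Sum>i\<in>{1, 2}. \<rho> i (t, x) * (Dt \<phi> (t, x) + v i (t, x) * Dx \<phi> (t, x)) * \<psi> (v i (t, x)))) = 0))"
    (is "_ \<and> _ \<and> (_ \<longleftrightarrow> ?tensor)")
proof -
  have I: "1 \<in> {1, 2::nat}" "2 \<in> {1, 2::nat}" by auto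
  note C1 = assms(2)[OF I(1)] assms(2)[OF I(2)] assms(3)[OF I(1)] assms(3)[OF I(2)]
  define m where "m i = mass_residual (\<rho> i) (v i)" for i
  define n where "n i p = \<rho> i p * burgers_residual (v i) p" for i p
  have flux: "Dt (\<lambda>q. \<rho> i q * v i q ^ k) p + Dx (\<lambda>q. \<rho> i q * v i q ^ (k + 1)) p =
      v i p ^ k * m i p + real k * v i p ^ (k - 1) * n i p" if "i \<in> {1, 2}" "p \<in> strip T" for i k p
    unfolding m_def n_def by (rule moment_flux[OF assms(2)[OF that(1)] assms(3)[OF that(1)] that(2)])
  \<comment> \<open>The common hub: each formulation is compared with this pointwise
    condition.\<close>
  define residuals_vanish where
    "residuals_vanish \<longleftrightarrow> (\<forall>p\<in>strip T. (m 1 p = 0 \<and> n 1 p = 0) \<and> (m 2 p = 0 \<and> n 2 p = 0))"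

  have pressureless: "pressureless_systems T \<rho> v \<longleftrightarrow> residuals_vanish"
  proof -
    have "(Dt (\<rho> i) p + Dx (\<lambda>q. \<rho> i q * v i q) p = 0 \<and>
        Dt (\<lambda>q. \<rho> i q * v i q) p + Dx (\<lambda>q. \<rho> i q * (v i q)\<^sup>2) p = 0) \<longleftrightarrow> m i p = 0 \<and> n i p = 0"
      if "i \<in> {1, 2}" "p \<in> strip T" for i p
      \<comment> \<open>For \<open>k = 0\<close> the flux identity gives \<open>m\<close>, for
        \<open>k = 1\<close> it gives \<open>v m + n\<close>; this system is triangular.\<close>
      using flux[OF that, of 0] flux[OF that, of 1] by (auto simp: power2_eq_square)
    then show ?thesis
      unfolding pressureless_systems_def residuals_vanish_def by auto
  qed

  have moments: "Dt (moment \<rho> v k) p + Dx (moment \<rho> v (k + 1)) p =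
      (v 1 p ^ k * m 1 p + real k * v 1 p ^ (k - 1) * n 1 p) +
      (v 2 p ^ k * m 2 p + real k * v 2 p ^ (k - 1) * n 2 p)" if p: "p \<in> strip T" for k p
  proof -
    have "C_k_on 1 (strip T) (\<lambda>q. \<rho> 1 q * v 1 q ^ j)" "C_k_on 1 (strip T) (\<lambda>q. \<rho> 2 q * v 2 q ^ j)" for j
      by (intro C_k_on_mult[OF open_strip] C_k_on_power[OF open_strip] C1)+
    from Dt_Dx_add(1)[OF this[of k] p] Dt_Dx_add(2)[OF this[of "k + 1"] p]
    show ?thesis
      unfolding flux[OF I(1) p, symmetric] flux[OF I(2) p, symmetric] moment_def[abs_def] by linarith
  qed
  have four: "four_moment_system T \<rho> v \<longleftrightarrow> residuals_vanish"
  proof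
    assume 4: "four_moment_system T \<rho> v"
    show residuals_vanish
      unfolding residuals_vanish_def
    proof
      fix p assume p: "p \<in> strip T"
      have E: "(v 1 p ^ k * m 1 p + real k * v 1 p ^ (k - 1) * n 1 p) +
          (v 2 p ^ k * m 2 p + real k * v 2 p ^ (k - 1) * n 2 p) = 0" if "k \<le> 3" for k
        unfolding moments[OF p, symmetric] using 4 p that by (simp add: four_moment_system_def)
      show "(m 1 p = 0 \<and> n 1 p = 0) \<and> (m 2 p = 0 \<and> n 2 p = 0)"
        \<comment> \<open>The interpolation lemma handles the first node only; commuting the sum
          exchanges the nodes.\<close>
        using hermite_moments_nonsingular[OF _ E] assms(6)[OF p]
          hermite_moments_nonsingular[OF _ E[unfolded add.commute[of "v 1 p ^ _ * _ + _"]]]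
        by simp
    qed
  next
    assume residuals_vanish
    then show "four_moment_system T \<rho> v"
      unfolding four_moment_system_def using moments by (simp add: residuals_vanish_def)
  qed

  have "\<forall>i\<in>{1, 2}. C_k_on 1 (strip T) (\<rho> i)" "\<forall>i\<in>{1, 2}. C_k_on 1 (strip T) (v i)"
    using assms(2,3) by blast+
  note pairing = free_transport_pairing[OF this, folded m_def n_def]
  have transport: "free_transport_distributional T (two_node_density \<rho> v)" if residuals_vanish
    unfolding free_transport_distributional_def
  proof (intro allI impI)
    fix \<Phi> :: "real \<times> real \<times> real \<Rightarrow> real"
    assume \<Phi>: "test_function ({0<..<T} \<times> UNIV \<times> UNIV) \<Phi>"
    have "\<Phi> (fst p, snd p, v i p) * m i p +
        frechet_derivative \<Phi> (at (fst p, snd p, v i p)) (0, 0, 1) * n i p = 0" if "i \<in> {1, 2}" for i p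
    \<comment> \<open>Nothing is known about the residuals off the strip, but there
      \<open>\<Phi>\<close> and its derivative vanish.\<close>
    proof (cases "p \<in> strip T")
      case True
      then show ?thesis
        using \<open>residuals_vanish\<close> that by (auto simp: residuals_vanish_def)
    next
      case False
      then have out: "(fst p, snd p, v i p) \<notin> closure {q. \<Phi> q \<noteq> 0}"
        using \<Phi> by (cases p) (auto simp: test_function_def strip_def)
      show ?thesis
        using test_function_eq_0[OF out]
          frechet_derivative_eq_0_off_support[OF out] by simp
    qed
    then show "(LBINT t:{0<..<T}. LBINT x. two_node_density \<rho> v (t, x)
        (\<lambda>\<xi>. Dt (\<lambda>(s, y). \<Phi> (s, y, \<xi>)) (t, x) + \<xi> * Dx (\<lambda>(s, y). \<Phi> (s, y, \<xi>)) (t, x))) = 0"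
      unfolding pairing[OF \<Phi>] by simp
  qed

  \<comment> \<open>The projections stay unevaluated to match syntactically the integrand obtained
    by instantiating \<open>\<Phi>\<close> with the product.\<close>
  have tensor_integrand: "two_node_density \<rho> v (t, x)
      (\<lambda>\<xi>. Dt (\<lambda>(s, y). \<phi> (fst (s, y, \<xi>), fst (snd (s, y, \<xi>))) * \<psi> (snd (snd (s, y, \<xi>)))) (t, x) +
        \<xi> * Dx (\<lambda>(s, y). \<phi> (fst (s, y, \<xi>), fst (snd (s, y, \<xi>))) * \<psi> (snd (snd (s, y, \<xi>)))) (t, x)) =
      (\<Sum>i\<in>{1, 2}. \<rho> i (t, x) * (Dt \<phi> (t, x) + v i (t, x) * Dx \<phi> (t, x)) * \<psi> (v i (t, x)))"
    if "test_function (strip T) \<phi>" "test_function UNIV \<psi>" for \<phi> \<psi> t x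
    unfolding tensor_derivatives(1,2)[OF that] two_node_density_def dirac_def
    by (simp add: distrib_right distrib_left mult.assoc)
  have tensor: ?tensor if F: "free_transport_distributional T (two_node_density \<rho> v)"
  proof (intro allI impI)
    fix \<phi> :: "real \<times> real \<Rightarrow> real" and \<psi> :: "real \<Rightarrow> real"
    assume \<phi>: "test_function (strip T) \<phi>" and \<psi>: "test_function UNIV \<psi>"
    from F[unfolded free_transport_distributional_def, rule_format, OF test_function_tensor[OF \<phi> \<psi>]]
    show "(LBINT t:{0<..<T}. LBINT x.
        (\<Sum>i\<in>{1, 2}. \<rho> i (t, x) * (Dt \<phi> (t, x) + v i (t, x) * Dx \<phi> (t, x)) * \<psi> (v i (t, x)))) = 0"
      unfolding tensor_integrand[OF \<phi> \<psi>] .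
  qed

  have residuals: residuals_vanish if P: ?tensor
    unfolding residuals_vanish_def
  proof
    fix p assume p: "p \<in> strip T"
    have E: "(\<psi> (v 1 p) * m 1 p + deriv \<psi> (v 1 p) * n 1 p) +
        (\<psi> (v 2 p) * m 2 p + deriv \<psi> (v 2 p) * n 2 p) = 0" if \<psi>: "test_function UNIV \<psi>" for \<psi>
    proof -
      define h where "h p = (\<psi> (v 1 p) * m 1 p + deriv \<psi> (v 1 p) * n 1 p) +
        (\<psi> (v 2 p) * m 2 p + deriv \<psi> (v 2 p) * n 2 p)" for p
      have \<psi>1: "C_k_on 1 UNIV \<psi>" using test_function_C_k_on[OF \<psi>] .
      have cont\<psi>: "continuous_on UNIV \<psi>" "continuous_on UNIV (deriv \<psi>)"
        using C_k_on_imp_continuous_on[OF \<psi>1] continuous_on_frechet_derivative[OF \<psi>1, of 1]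
        unfolding C_1_deriv(2)[OF \<psi>1] by auto
      \<comment> \<open>Only first derivatives of \<open>\<rho>\<close>, \<open>v\<close> and
        \<open>\<psi>\<close> enter \<open>h\<close>, so \<open>C^1\<close> data are enough for the
        fundamental lemma.\<close>
      have "continuous_on (strip T) h"
        unfolding h_def m_def n_def mass_residual_def burgers_residual_def
        by (intro continuous_on_add continuous_on_mult continuous_on_Dt continuous_on_Dx
            C_k_on_mult[OF open_strip] C1 continuous_on_compose2[OF cont\<psi>(1)]
            continuous_on_compose2[OF cont\<psi>(2)] C1[THEN C_k_on_imp_continuous_on] subset_UNIV)
      moreover have "(LINT p|lborel. \<phi> p * h p) = 0" if \<phi>: "test_function (strip T) \<phi>" for \<phi>
      proof -
        have eq: "(\<Sum>i\<in>{1, 2}. \<phi> (fst (fst p, snd p, v i p), fst (snd (fst p, snd p, v i p))) *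
            \<psi> (snd (snd (fst p, snd p, v i p))) * m i p +
            \<phi> (fst p, snd p) * deriv \<psi> (v i p) * n i p) = \<phi> p * h p" for p
          by (simp add: h_def distrib_left mult.assoc)
        from pairing[OF test_function_tensor[OF \<phi> \<psi>], unfolded tensor_integrand[OF \<phi> \<psi>]
            tensor_derivatives(3)[OF \<phi> \<psi>] eq P[rule_format, OF \<phi> \<psi>]]
        show ?thesis by simp
      qed
      ultimately have "h p = 0"
        by (rule fundamental_lemma_calculus_of_variations[OF open_strip _ _ p])
      then show ?thesis by (simp add: h_def)
    qed
    have "v 1 p \<noteq> v 2 p" using assms(6)[OF p] by simp
    then show "(m 1 p = 0 \<and> n 1 p = 0) \<and> (m 2 p = 0 \<and> n 2 p = 0)"
      using test_functions_separate_jets[of "v 1 p" "v 2 p", OF _ E]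
        test_functions_separate_jets[of "v 2 p" "v 1 p", OF _ E[unfolded add.commute[of "_ (v 1 p) * _ + _"]]]
      by simp
  qed

  show ?thesis
    \<comment> \<open>Vanishing residuals imply transport, transport implies the product form, and
      that returns vanishing residuals, closing the cycle.\<close>
    using four pressureless transport tensor residuals by blast
qed

end
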